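(* For any formulas $A(p)$ and $B$, if the formula $A(p)\rhd B$ is left-modalized in $p$, then $F := A(\Box\neg A(\top))\rhd B$ is a fixed point of $A(p)\rhd B$ in $\mathbf{IL}^-(\mathbf{J4},\mathbf{J5})$; that is, $\mathbf{IL}^-(\mathbf{J4},\mathbf{J5}) \vdash F \leftrightarrow (A(F)\rhd B)$. Therefore $\mathbf{IL}^-(\mathbf{J4},\mathbf{J5})$ has $\ell$FPP: for any formula $D(p)$ which is left-modalized in $p$, there exists a formula $G$ such that $v(G)\subseteq v(D)\setminus\{p\}$ and $\mathbf{IL}^-(\mathbf{J4},\mathbf{J5}) \vdash G\leftrightarrow D(G)$.
   Context: Formulas are generated by $A ::= \bot \mid p \mid A \to A \mid \Box A \mid A \rhd A$, where $p$ ranges over a countably infinite set of propositional variables. The symbols $\neg,\land,\lor,\leftrightarrow,\top,\Diamond$ (with $\Diamond A := \neg\Box\neg A$) are the usual abbreviations. $\neg,\Box,\Diamond$ bind most strongly. $v(A)$ is the set of propositional variables contained in $A$. For a formula $A(p)$ (which may contain other variables), $A(B)$ denotes the result of substituting $B$ for all occurrences of $p$ in $A(p)$. The logic $\mathbf{IL}^-$ has as axioms all instances of: $\mathbf{L1}$: all tautologies in this language; $\mathbf{L2}$: $\Box(A\to B)\to(\Box A\to\Box B)$; $\mathbf{L3}$: $\Box(\Box A\to A)\to\Box A$; $\mathbf{J3}$: $((A\rhd C)\land(B\rhd C))\to((A\lor B)\rhd C)$; $\mathbf{J6}$: $\Box A\leftrightarrow((\neg A)\rhd\bot)$. Its inference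 rules are Modus Ponens, Necessitation (from $A$ infer $\Box A$), $\mathbf{R1}$ (from $A\to B$ infer $(C\rhd A)\to(C\rhd B)$) and $\mathbf{R2}$ (from $A\to B$ infer $(B\rhd C)\to(A\rhd C)$). $\mathbf{IL}^-(\Sigma_1,\ldots,\Sigma_n)$ is the logic obtained from $\mathbf{IL}^-$ by adding the schemata $\Sigma_1,\ldots,\Sigma_n$ as axiom schemata (with the same rules). $\mathbf{J4}$ is the schema $(A\rhd B)\to(\Diamond A\to\Diamond B)$ and $\mathbf{J5}$ is the schema $\Diamond A\rhd A$. $L\vdash A$ means that $A$ is a theorem of $L$. A formula $A$ is modalized in $p$ if every occurrence of $p$ in $A$ is in the scope of some modal operator $\Box$ or $\rhd$. A formula $A$ is left-modalized in $p$ if $A$ is modalized in $p$ and $p\notin v(C)$ for any subformula $B\rhd C$ of $A$. *)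

theory Defs
  imports Main
begin

datatype fm =
    Bot (\<open>\<^bold>\<bottom>\<close>)
  | Var nat
  | Imp fm fm (infixr \<open>\<^bold>\<rightarrow>\<close> 55)
  | Box fm (\<open>\<^bold>\<box> _\<close> [80] 80)
  | Rhd fm fm (infix \<open>\<rhd>\<close> 60)

abbreviation Neg :: "fm \<Rightarrow> fm" (\<open>\<^bold>\<not> _\<close> [80] 80) where
  "\<^bold>\<not> A \<equiv> A \<^bold>\<rightarrow> \<^bold>\<bottom>"

abbreviation Top :: fm (\<open>\<^bold>\<top>\<close>) where
  "\<^bold>\<top> \<equiv> \<^bold>\<not> \<^bold>\<bottom>"

abbreviation Or :: "fm \<Rightarrow> fm \<Rightarrow> fm" (infixr \<open>\<^bold>\<or>\<close> 65) where
  "A \<^bold>\<or> B \<equiv> \<^bold>\<not> A \<^bold>\<rightarrow> B"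

abbreviation And :: "fm \<Rightarrow> fm \<Rightarrow> fm" (infixr \<open>\<^bold>\<and>\<close> 70) where
  "A \<^bold>\<and> B \<equiv> \<^bold>\<not> (A \<^bold>\<rightarrow> \<^bold>\<not> B)"

abbreviation Iff :: "fm \<Rightarrow> fm \<Rightarrow> fm" (infix \<open>\<^bold>\<leftrightarrow>\<close> 50) where
  "A \<^bold>\<leftrightarrow> B \<equiv> (A \<^bold>\<rightarrow> B) \<^bold>\<and> (B \<^bold>\<rightarrow> A)"

abbreviation Dia :: "fm \<Rightarrow> fm" (\<open>\<^bold>\<diamond> _\<close> [80] 80) where
  "\<^bold>\<diamond> A \<equiv> \<^bold>\<not> \<^bold>\<box> \<^bold>\<not> A"

primrec vars :: "fm \<Rightarrow> nat set" where
  "vars \<^bold>\<bottom> = {}"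
| "vars (Var q) = {q}"
| "vars (A \<^bold>\<rightarrow> B) = vars A \<union> vars B"
| "vars (\<^bold>\<box> A) = vars A"
| "vars (A \<rhd> B) = vars A \<union> vars B"

text \<open>\<open>subst p B A\<close> is \<open>A(B)\<close>, the result of replacing every occurrence of \<open>p\<close> in \<open>A\<close> by \<open>B\<close>.\<close>

primrec subst :: "nat \<Rightarrow> fm \<Rightarrow> fm \<Rightarrow> fm" where
  "subst p B \<^bold>\<bottom> = \<^bold>\<bottom>"
| "subst p B (Var q) = (if q = p then B else Var q)"
| "subst p B (A1 \<^bold>\<rightarrow> A2) = subst p B A1 \<^bold>\<rightarrow> subst p B A2"
| "subst p B (\<^bold>\<box> A) = \<^bold>\<box> (subst p B A)"
| "subst p B (A1 \<rhd> A2) = subst p B A1 \<rhd> subst p B A2"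

primrec subformulas :: "fm \<Rightarrow> fm set" where
  "subformulas \<^bold>\<bottom> = {\<^bold>\<bottom>}"
| "subformulas (Var q) = {Var q}"
| "subformulas (A \<^bold>\<rightarrow> B) = insert (A \<^bold>\<rightarrow> B) (subformulas A \<union> subformulas B)"
| "subformulas (\<^bold>\<box> A) = insert (\<^bold>\<box> A) (subformulas A)"
| "subformulas (A \<rhd> B) = insert (A \<rhd> B) (subformulas A \<union> subformulas B)"

text \<open>Every occurrence of \<open>p\<close> lies in the scope of some \<open>\<^bold>\<box>\<close> or \<open>\<rhd>\<close>: the recursion stops,
  with nothing left to check, as soon as it meets a modal operator.\<close>

primrec modalized :: "nat \<Rightarrow> fm \<Rightarrow> bool" where
  "modalized p \<^bold>\<bottom> \<longleftrightarrow> True"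
| "modalized p (Var q) \<longleftrightarrow> q \<noteq> p"
| "modalized p (A \<^bold>\<rightarrow> B) \<longleftrightarrow> modalized p A \<and> modalized p B"
| "modalized p (\<^bold>\<box> A) \<longleftrightarrow> True"
| "modalized p (A \<rhd> B) \<longleftrightarrow> True"

definition left_modalized :: "nat \<Rightarrow> fm \<Rightarrow> bool" where
  "left_modalized p A \<longleftrightarrow>
     modalized p A \<and> (\<forall>B C. B \<rhd> C \<in> subformulas A \<longrightarrow> p \<notin> vars C)"

text \<open>Tautologies of the modal language: formulas true under every truth assignment that treats
  variables and formulas of the form \<open>\<^bold>\<box> A\<close> and \<open>A \<rhd> B\<close> as atoms. Only the values of \<open>v\<close> on such
  formulas matter.\<close>

primrec bool_eval :: "(fm \<Rightarrow> bool) \<Rightarrow> fm \<Rightarrow> bool" where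
  "bool_eval v \<^bold>\<bottom> \<longleftrightarrow> False"
| "bool_eval v (Var q) \<longleftrightarrow> v (Var q)"
| "bool_eval v (A \<^bold>\<rightarrow> B) \<longleftrightarrow> (bool_eval v A \<longrightarrow> bool_eval v B)"
| "bool_eval v (\<^bold>\<box> A) \<longleftrightarrow> v (\<^bold>\<box> A)"
| "bool_eval v (A \<rhd> B) \<longleftrightarrow> v (A \<rhd> B)"

definition tautology :: "fm \<Rightarrow> bool" where
  "tautology A \<longleftrightarrow> (\<forall>v. bool_eval v A)"

text \<open>A schema is represented by the set of its instances; \<open>IL_minus \<Sigma>\<close> is the set of theorems
  (as a predicate) of the extension of the base logic by the schemata in \<open>\<Sigma>\<close>.\<close>

type_synonym schema = "fm set"

inductive IL_minus :: "schema set \<Rightarrow> fm \<Rightarrow> bool" for \<Sigma> :: "schema set" where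
  L1: "tautology A \<Longrightarrow> IL_minus \<Sigma> A"
| L2: "IL_minus \<Sigma> (\<^bold>\<box> (A \<^bold>\<rightarrow> B) \<^bold>\<rightarrow> (\<^bold>\<box> A \<^bold>\<rightarrow> \<^bold>\<box> B))"
| L3: "IL_minus \<Sigma> (\<^bold>\<box> (\<^bold>\<box> A \<^bold>\<rightarrow> A) \<^bold>\<rightarrow> \<^bold>\<box> A)"
| J3: "IL_minus \<Sigma> (((A \<rhd> C) \<^bold>\<and> (B \<rhd> C)) \<^bold>\<rightarrow> ((A \<^bold>\<or> B) \<rhd> C))"
| J6: "IL_minus \<Sigma> (\<^bold>\<box> A \<^bold>\<leftrightarrow> ((\<^bold>\<not> A) \<rhd> \<^bold>\<bottom>))"
| Ax: "S \<in> \<Sigma> \<Longrightarrow> A \<in> S \<Longrightarrow> IL_minus \<Sigma> A"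
| MP: "IL_minus \<Sigma> (A \<^bold>\<rightarrow> B) \<Longrightarrow> IL_minus \<Sigma> A \<Longrightarrow> IL_minus \<Sigma> B"
| Nec: "IL_minus \<Sigma> A \<Longrightarrow> IL_minus \<Sigma> (\<^bold>\<box> A)"
| R1: "IL_minus \<Sigma> (A \<^bold>\<rightarrow> B) \<Longrightarrow> IL_minus \<Sigma> ((C \<rhd> A) \<^bold>\<rightarrow> (C \<rhd> B))"
| R2: "IL_minus \<Sigma> (A \<^bold>\<rightarrow> B) \<Longrightarrow> IL_minus \<Sigma> ((B \<rhd> C) \<^bold>\<rightarrow> (A \<rhd> C))"

definition J4 :: schema where
  "J4 = {(A \<rhd> B) \<^bold>\<rightarrow> (\<^bold>\<diamond> A \<^bold>\<rightarrow> \<^bold>\<diamond> B) | A B. True}"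

definition J5 :: schema where
  "J5 = {\<^bold>\<diamond> A \<rhd> A | A. True}"

definition has_lFPP :: "(fm \<Rightarrow> bool) \<Rightarrow> bool" where
  "has_lFPP L \<longleftrightarrow>
     (\<forall>p D. left_modalized p D \<longrightarrow>
        (\<exists>G. vars G \<subseteq> vars D - {p} \<and> L (G \<^bold>\<leftrightarrow> subst p G D)))"

end

theory Submission
  imports Defs
begin

text \<open>Write \<open>S = \<box>\<not>A(\<top>)\<close>, \<open>C = A(S)\<close> and \<open>F = C \<rhd> B\<close>. Since \<open>S\<close> implies \<open>S \<leftrightarrow> \<top>\<close> hereditarily,
  Loeb's axiom gives \<open>\<box>\<not>C \<leftrightarrow> S\<close>. Under \<open>\<box>\<not>B\<close>, J4 turns \<open>F\<close> into \<open>\<box>\<not>C\<close>, hence into \<open>S\<close>, so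
  \<open>A(F) \<leftrightarrow> C\<close>. Therefore \<open>A(F)\<close> and \<open>C\<close> agree up to \<open>\<diamond>B\<close>, and \<open>\<diamond>B \<rhd> B\<close> by J5, so that J3 yields
  \<open>C \<rhd> B \<leftrightarrow> A(F) \<rhd> B\<close>.

  For an arbitrary left-modalized \<open>D(p)\<close>, one outermost modal component \<open>M(p)\<close> is replaced by a
  fresh variable \<open>q\<close>. Given a fixed point \<open>G(q)\<close> of the resulting formula, the first part solves
  \<open>q \<leftrightarrow> M(G(q))\<close>, and the solution is substituted for \<open>q\<close> in \<open>G(q)\<close>.\<close>

section \<open>Propositional reasoning inside the logic\<close>

lemma IL_taut1:
  assumes "IL_minus \<Sigma> A" "tautology (A \<^bold>\<rightarrow> B)"
  shows "IL_minus \<Sigma> B"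
  using IL_minus.L1[OF assms(2)] assms(1) by (rule IL_minus.MP)

lemma IL_taut2:
  assumes "IL_minus \<Sigma> A" "IL_minus \<Sigma> B" "tautology (A \<^bold>\<rightarrow> B \<^bold>\<rightarrow> C)"
  shows "IL_minus \<Sigma> C"
  using IL_taut1[OF assms(1,3)] assms(2) by (rule IL_minus.MP)

lemma IL_taut3:
  assumes "IL_minus \<Sigma> A" "IL_minus \<Sigma> B" "IL_minus \<Sigma> C" "tautology (A \<^bold>\<rightarrow> B \<^bold>\<rightarrow> C \<^bold>\<rightarrow> D)"
  shows "IL_minus \<Sigma> D"
  using IL_taut2[OF assms(1,2,4)] assms(3) by (rule IL_minus.MP)

lemma IL_iffD1: "IL_minus \<Sigma> (A \<^bold>\<leftrightarrow> B) \<Longrightarrow> IL_minus \<Sigma> (A \<^bold>\<rightarrow> B)"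
  by (erule IL_taut1) (unfold tautology_def bool_eval.simps, blast)

lemma IL_iffD2: "IL_minus \<Sigma> (A \<^bold>\<leftrightarrow> B) \<Longrightarrow> IL_minus \<Sigma> (B \<^bold>\<rightarrow> A)"
  by (erule IL_taut1) (unfold tautology_def bool_eval.simps, blast)

lemma IL_iffI: "IL_minus \<Sigma> (A \<^bold>\<rightarrow> B) \<Longrightarrow> IL_minus \<Sigma> (B \<^bold>\<rightarrow> A) \<Longrightarrow> IL_minus \<Sigma> (A \<^bold>\<leftrightarrow> B)"
  by (rule IL_taut2, assumption, assumption) (unfold tautology_def bool_eval.simps, blast)

lemma IL_imp_trans:
  "IL_minus \<Sigma> (A \<^bold>\<rightarrow> B) \<Longrightarrow> IL_minus \<Sigma> (B \<^bold>\<rightarrow> C) \<Longrightarrow> IL_minus \<Sigma> (A \<^bold>\<rightarrow> C)"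
  by (rule IL_taut2, assumption, assumption) (unfold tautology_def bool_eval.simps, blast)

lemma IL_iff_trans:
  "IL_minus \<Sigma> (A \<^bold>\<leftrightarrow> B) \<Longrightarrow> IL_minus \<Sigma> (B \<^bold>\<leftrightarrow> C) \<Longrightarrow> IL_minus \<Sigma> (A \<^bold>\<leftrightarrow> C)"
  by (rule IL_taut2, assumption, assumption) (unfold tautology_def bool_eval.simps, blast)

section \<open>Derived principles for \<open>\<box>\<close> and \<open>\<rhd>\<close>\<close>

lemma IL_Box_mono: "IL_minus \<Sigma> (A \<^bold>\<rightarrow> B) \<Longrightarrow> IL_minus \<Sigma> (\<^bold>\<box> A \<^bold>\<rightarrow> \<^bold>\<box> B)"
  by (rule IL_minus.MP[OF IL_minus.L2 IL_minus.Nec])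

lemma IL_Box_mono2:
  assumes "IL_minus \<Sigma> (A \<^bold>\<rightarrow> B \<^bold>\<rightarrow> C)"
  shows "IL_minus \<Sigma> (\<^bold>\<box> A \<^bold>\<rightarrow> \<^bold>\<box> B \<^bold>\<rightarrow> \<^bold>\<box> C)"
  using IL_Box_mono[OF assms] IL_minus.L2 by (rule IL_imp_trans)

text \<open>Transitivity is the standard consequence of Loeb's axiom, applied to the conjunction of
  \<open>\<box> A\<close> and \<open>A\<close>.\<close>

lemma IL_four: "IL_minus \<Sigma> (\<^bold>\<box> A \<^bold>\<rightarrow> \<^bold>\<box> \<^bold>\<box> A)"
proof -
  let ?B = "\<^bold>\<box> A \<^bold>\<and> A"
  have 1: "IL_minus \<Sigma> (\<^bold>\<box> ?B \<^bold>\<rightarrow> \<^bold>\<box> A)"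
    by (intro IL_Box_mono IL_minus.L1) (unfold tautology_def bool_eval.simps, blast)
  have "IL_minus \<Sigma> (A \<^bold>\<rightarrow> (\<^bold>\<box> ?B \<^bold>\<rightarrow> ?B))"
    using 1 by (rule IL_taut1) (unfold tautology_def bool_eval.simps, blast)
  from IL_imp_trans[OF IL_Box_mono[OF this] IL_minus.L3]
  have "IL_minus \<Sigma> (\<^bold>\<box> A \<^bold>\<rightarrow> \<^bold>\<box> ?B)" .
  moreover have "IL_minus \<Sigma> (\<^bold>\<box> ?B \<^bold>\<rightarrow> \<^bold>\<box> \<^bold>\<box> A)"
    by (intro IL_Box_mono IL_minus.L1) (unfold tautology_def bool_eval.simps, blast)
  ultimately show ?thesis by (rule IL_imp_trans)
qed

text \<open>J6 reads the box as \<open>\<rhd> \<bottom>\<close>; R2 removes the double negation on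
  the left and R1 weakens \<open>\<bottom>\<close> on the right.\<close>

lemma IL_Box_Neg_Rhd: "IL_minus \<Sigma> (\<^bold>\<box> \<^bold>\<not> A \<^bold>\<rightarrow> (A \<rhd> B))"
proof -
  have "IL_minus \<Sigma> (\<^bold>\<box> \<^bold>\<not> A \<^bold>\<rightarrow> ((\<^bold>\<not> \<^bold>\<not> A) \<rhd> \<^bold>\<bottom>))"
    using IL_minus.J6 by (rule IL_iffD1)
  moreover have "IL_minus \<Sigma> (((\<^bold>\<not> \<^bold>\<not> A) \<rhd> \<^bold>\<bottom>) \<^bold>\<rightarrow> (A \<rhd> \<^bold>\<bottom>))"
    by (intro IL_minus.R2 IL_minus.L1) (unfold tautology_def bool_eval.simps, blast)
  moreover have "IL_minus \<Sigma> ((A \<rhd> \<^bold>\<bottom>) \<^bold>\<rightarrow> (A \<rhd> B))"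
    by (intro IL_minus.R1 IL_minus.L1) (unfold tautology_def bool_eval.simps, blast)
  ultimately show ?thesis by (rule IL_imp_trans[OF IL_imp_trans])
qed

lemma IL_Rhd_cases:
  assumes "IL_minus \<Sigma> (A \<^bold>\<rightarrow> B \<^bold>\<or> C)"
  shows "IL_minus \<Sigma> ((B \<rhd> E) \<^bold>\<rightarrow> (C \<rhd> E) \<^bold>\<rightarrow> (A \<rhd> E))"
  using IL_minus.J3[of \<Sigma> B E C] IL_minus.R2[OF assms, of E]
  by (rule IL_taut2) (unfold tautology_def bool_eval.simps, blast)

text \<open>An internal form of R2. \<open>A\<close> implies \<open>?N \<or> B\<close>, the boxed
  hypothesis refutes \<open>?N\<close> and so gives \<open>?N \<rhd> C\<close>, and J3 combines this
  with \<open>B \<rhd> C\<close>.\<close>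

lemma IL_Box_imp_Rhd: "IL_minus \<Sigma> (\<^bold>\<box> (A \<^bold>\<rightarrow> B) \<^bold>\<rightarrow> (B \<rhd> C) \<^bold>\<rightarrow> (A \<rhd> C))"
proof -
  let ?N = "\<^bold>\<not> (A \<^bold>\<rightarrow> B)"
  have 1: "IL_minus \<Sigma> (\<^bold>\<box> (A \<^bold>\<rightarrow> B) \<^bold>\<rightarrow> \<^bold>\<box> \<^bold>\<not> ?N)"
    by (intro IL_Box_mono IL_minus.L1) (unfold tautology_def bool_eval.simps, blast)
  have "IL_minus \<Sigma> ((?N \<rhd> C) \<^bold>\<rightarrow> (B \<rhd> C) \<^bold>\<rightarrow> (A \<rhd> C))"
    by (intro IL_Rhd_cases IL_minus.L1) (unfold tautology_def bool_eval.simps, blast)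
  with IL_imp_trans[OF 1 IL_Box_Neg_Rhd[of \<Sigma> ?N C]] show ?thesis
    by (rule IL_imp_trans)
qed

lemma IL_Box_iff_imp: "IL_minus \<Sigma> (\<^bold>\<box> (A \<^bold>\<leftrightarrow> B) \<^bold>\<rightarrow> \<^bold>\<box> (A \<^bold>\<rightarrow> B))"
  by (intro IL_Box_mono IL_minus.L1) (unfold tautology_def bool_eval.simps, blast)

lemma IL_Box_iff_imp': "IL_minus \<Sigma> (\<^bold>\<box> (A \<^bold>\<leftrightarrow> B) \<^bold>\<rightarrow> \<^bold>\<box> (B \<^bold>\<rightarrow> A))"
  by (intro IL_Box_mono IL_minus.L1) (unfold tautology_def bool_eval.simps, blast)

lemma IL_Box_iff_Rhd: "IL_minus \<Sigma> (\<^bold>\<box> (A \<^bold>\<leftrightarrow> B) \<^bold>\<rightarrow> ((A \<rhd> C) \<^bold>\<leftrightarrow> (B \<rhd> C)))"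
  using IL_imp_trans[OF IL_Box_iff_imp[of \<Sigma> A B] IL_Box_imp_Rhd[of \<Sigma> A B C]]
    IL_imp_trans[OF IL_Box_iff_imp'[of \<Sigma> A B] IL_Box_imp_Rhd[of \<Sigma> B A C]]
  by (rule IL_taut2) (unfold tautology_def bool_eval.simps, blast)

lemma IL_Box_iff_Box: "IL_minus \<Sigma> (\<^bold>\<box> (A \<^bold>\<leftrightarrow> B) \<^bold>\<rightarrow> (\<^bold>\<box> A \<^bold>\<leftrightarrow> \<^bold>\<box> B))"
  using IL_imp_trans[OF IL_Box_iff_imp[of \<Sigma> A B] IL_minus.L2]
    IL_imp_trans[OF IL_Box_iff_imp'[of \<Sigma> A B] IL_minus.L2]
  by (rule IL_taut2) (unfold tautology_def bool_eval.simps, blast)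

section \<open>Variables in right arguments, and syntactic substitution\<close>

text \<open>The second clause of \<open>left_modalized\<close> says that \<open>p\<close> avoids
  this set. The set form allows inclusions to be tracked through substitutions.\<close>

primrec rvars :: "fm \<Rightarrow> nat set" where
  "rvars \<^bold>\<bottom> = {}"
| "rvars (Var q) = {}"
| "rvars (A \<^bold>\<rightarrow> B) = rvars A \<union> rvars B"
| "rvars (\<^bold>\<box> A) = rvars A"
| "rvars (A \<rhd> B) = rvars A \<union> vars B"

lemma rvars_subset_vars: "rvars A \<subseteq> vars A"
  by (induction A) auto

lemma finite_vars: "finite (vars A)"
  by (induction A) auto

lemma mem_rvars_iff: "p \<in> rvars A \<longleftrightarrow> (\<exists>B C. B \<rhd> C \<in> subformulas A \<and> p \<in> vars C)"
proof (induction A)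
  case (Rhd A B)
  have "p \<in> rvars B \<Longrightarrow> p \<in> vars B" using rvars_subset_vars by blast
  with Rhd show ?case by auto
qed auto

lemma left_modalized_iff: "left_modalized p A \<longleftrightarrow> modalized p A \<and> p \<notin> rvars A"
  unfolding left_modalized_def mem_rvars_iff by blast

lemma subst_notin [simp]: "p \<notin> vars A \<Longrightarrow> subst p B A = A"
  by (induction A) auto

lemma vars_subst: "vars (subst p B A) \<subseteq> (vars A - {p}) \<union> vars B"
  by (induction A) auto

text \<open>If \<open>p\<close> occurred in a right argument, all variables of \<open>B\<close>
  would enter right arguments; otherwise \<open>B\<close> contributes only its own.\<close>

lemma rvars_subst: "p \<notin> rvars A \<Longrightarrow> rvars (subst p B A) \<subseteq> rvars A \<union> rvars B"
  by (induction A) auto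

lemma notin_vars_subst: "p \<notin> vars B \<Longrightarrow> p \<notin> vars (subst p B A)"
  using vars_subst by blast

lemma subst_subst_outer:
  "q \<notin> vars F \<Longrightarrow> p \<noteq> q \<Longrightarrow>
   subst q F (subst p G A) = subst q F (subst p (subst q F G) A)"
  by (induction A) (auto simp: notin_vars_subst)

lemma subst_subst_inner:
  "q \<notin> vars G \<Longrightarrow> p \<noteq> q \<Longrightarrow>
   subst p G (subst q M A) = subst q (subst p G M) (subst p G A)"
  by (induction A) auto

lemma subst_subst_fresh:
  "q \<notin> vars A \<Longrightarrow> subst q F (subst p G A) = subst p (subst q F G) A"
  by (induction A) auto

section \<open>Closure under substitution, and replacement of equivalents\<close>

text \<open>Pulling \<open>v\<close> back along the substitution gives a valuation of the atoms, so
  substitution instances of tautologies are tautologies.\<close>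

lemma bool_eval_subst:
  "bool_eval v (subst p B A) = bool_eval (\<lambda>E. bool_eval v (subst p B E)) A"
  by (induction A) auto

lemma IL_subst:
  assumes "IL_minus \<Sigma> A" and closed: "\<And>S E. S \<in> \<Sigma> \<Longrightarrow> E \<in> S \<Longrightarrow> subst p B E \<in> S"
  shows "IL_minus \<Sigma> (subst p B A)"
  using assms(1)
proof induction
  case (L1 A)
  thus ?case unfolding tautology_def
    by (intro IL_minus.L1) (simp add: tautology_def bool_eval_subst[of _ p B A])
next
  case (Ax S A)
  thus ?case using closed IL_minus.Ax by blast
next
  case (MP A B)
  thus ?case using IL_minus.MP by simp
qed (simp_all add: IL_minus.intros(2-5) IL_minus.Nec IL_minus.R1 IL_minus.R2)

lemma IL_J4_J5_subst: "IL_minus {J4, J5} A \<Longrightarrow> IL_minus {J4, J5} (subst p B A)"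
  by (rule IL_subst) (auto simp: J4_def J5_def)

text \<open>The equivalence is a theorem here, so R1 covers right arguments and \<open>E\<close> is
  arbitrary.\<close>

lemma IL_subst_cong:
  assumes "IL_minus \<Sigma> (A \<^bold>\<leftrightarrow> B)"
  shows "IL_minus \<Sigma> (subst p A E \<^bold>\<leftrightarrow> subst p B E)"
proof (induction E)
  case Bot
  show ?case by (intro IL_minus.L1) (simp add: tautology_def)
next
  case (Var q)
  have "IL_minus \<Sigma> (Var q \<^bold>\<leftrightarrow> Var q)" by (intro IL_minus.L1) (unfold tautology_def bool_eval.simps, blast)
  with assms show ?case by simp
next
  case (Imp E1 E2)
  thus ?case unfolding subst.simps by (rule IL_taut2) (unfold tautology_def bool_eval.simps, blast)
next
  case (Box E)
  show ?case unfolding subst.simps using IL_Box_iff_Box IL_minus.Nec[OF Box] by (rule IL_minus.MP)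
next
  case (Rhd E1 E2)
  note R = IL_minus.R1[OF IL_iffD1[OF Rhd(2)]] IL_minus.R1[OF IL_iffD2[OF Rhd(2)]]
  have "IL_minus \<Sigma> ((subst p A E1 \<rhd> subst p A E2) \<^bold>\<leftrightarrow> (subst p B E1 \<rhd> subst p A E2))"
    using IL_Box_iff_Rhd IL_minus.Nec[OF Rhd(1)] by (rule IL_minus.MP)
  moreover have "IL_minus \<Sigma> ((subst p B E1 \<rhd> subst p A E2) \<^bold>\<leftrightarrow> (subst p B E1 \<rhd> subst p B E2))"
    using R by (rule IL_iffI)
  ultimately show ?case unfolding subst.simps by (rule IL_iff_trans)
qed

text \<open>The equivalence is now only a hypothesis. Its boxed form acts on left arguments through
  \<open>IL_Box_iff_Rhd\<close>; right arguments stay fixed because \<open>p\<close> is absent from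
  them.\<close>

lemma IL_subst_cong_local:
  assumes "p \<notin> rvars E"
  shows "IL_minus \<Sigma> ((A \<^bold>\<leftrightarrow> B) \<^bold>\<and> \<^bold>\<box> (A \<^bold>\<leftrightarrow> B) \<^bold>\<rightarrow> (subst p A E \<^bold>\<leftrightarrow> subst p B E))"
    (is "IL_minus \<Sigma> (?H \<^bold>\<rightarrow> _)")
  using assms
proof (induction E)
  case Bot
  show ?case by (intro IL_minus.L1) (simp add: tautology_def)
next
  case (Var q)
  show ?case by (intro IL_minus.L1) (auto simp: tautology_def)
next
  case (Imp E1 E2)
  hence "IL_minus \<Sigma> (?H \<^bold>\<rightarrow> (subst p A E1 \<^bold>\<leftrightarrow> subst p B E1))"
    "IL_minus \<Sigma> (?H \<^bold>\<rightarrow> (subst p A E2 \<^bold>\<leftrightarrow> subst p B E2))" by auto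
  thus ?case unfolding subst.simps by (rule IL_taut2) (unfold tautology_def bool_eval.simps, blast)
next
  case (Box E)
  hence IH: "IL_minus \<Sigma> (?H \<^bold>\<rightarrow> (subst p A E \<^bold>\<leftrightarrow> subst p B E))" by auto
  \<comment> \<open>Boxing the induction hypothesis boxes both conjuncts of \<open>?H\<close>;
    \<open>IL_four\<close> then supplies the doubly boxed one.\<close>
  have "IL_minus \<Sigma> (\<^bold>\<box> (A \<^bold>\<leftrightarrow> B) \<^bold>\<rightarrow> \<^bold>\<box> \<^bold>\<box> (A \<^bold>\<leftrightarrow> B) \<^bold>\<rightarrow> \<^bold>\<box> (subst p A E \<^bold>\<leftrightarrow> subst p B E))"
    by (rule IL_Box_mono2, rule IL_taut1, rule IH) (unfold tautology_def bool_eval.simps, blast)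
  from this IL_four[of \<Sigma> "A \<^bold>\<leftrightarrow> B"] IL_Box_iff_Box[of \<Sigma> "subst p A E" "subst p B E"]
  show ?case unfolding subst.simps by (rule IL_taut3) (unfold tautology_def bool_eval.simps, blast)
next
  case (Rhd E1 E2)
  hence "p \<notin> vars E2" and IH: "IL_minus \<Sigma> (?H \<^bold>\<rightarrow> (subst p A E1 \<^bold>\<leftrightarrow> subst p B E1))" by auto
  have "IL_minus \<Sigma> (\<^bold>\<box> (A \<^bold>\<leftrightarrow> B) \<^bold>\<rightarrow> \<^bold>\<box> \<^bold>\<box> (A \<^bold>\<leftrightarrow> B) \<^bold>\<rightarrow> \<^bold>\<box> (subst p A E1 \<^bold>\<leftrightarrow> subst p B E1))"
    by (rule IL_Box_mono2, rule IL_taut1, rule IH) (unfold tautology_def bool_eval.simps, blast)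
  from this IL_four[of \<Sigma> "A \<^bold>\<leftrightarrow> B"] IL_Box_iff_Rhd[of \<Sigma> "subst p A E1" "subst p B E1" E2]
  have "IL_minus \<Sigma> (?H \<^bold>\<rightarrow> ((subst p A E1 \<rhd> E2) \<^bold>\<leftrightarrow> (subst p B E1 \<rhd> E2)))"
    by (rule IL_taut3) (unfold tautology_def bool_eval.simps, blast)
  with \<open>p \<notin> vars E2\<close> show ?case by simp
qed

lemma IL_subst_cong_boxed:
  assumes "p \<notin> rvars E" "IL_minus \<Sigma> (\<^bold>\<box> Z \<^bold>\<rightarrow> (A \<^bold>\<leftrightarrow> B))"
  shows "IL_minus \<Sigma> (\<^bold>\<box> Z \<^bold>\<rightarrow> (subst p A E \<^bold>\<leftrightarrow> subst p B E))"
  using IL_subst_cong_local[OF assms(1), of \<Sigma> A B] assms(2)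
    IL_imp_trans[OF IL_four IL_Box_mono[OF assms(2)]]
  by (rule IL_taut3) (unfold tautology_def bool_eval.simps, blast)

section \<open>The explicit fixed point of a formula \<open>A \<rhd> B\<close>\<close>

abbreviation fp :: "nat \<Rightarrow> fm \<Rightarrow> fm \<Rightarrow> fm" where
  "fp p A B \<equiv> subst p (\<^bold>\<box> \<^bold>\<not> (subst p \<^bold>\<top> A)) A \<rhd> B"

lemma fp_Rhd:
  assumes "p \<notin> rvars A"
  shows "IL_minus {J4, J5} (fp p A B \<^bold>\<leftrightarrow> (subst p (fp p A B) A \<rhd> B))"
proof -
  define X S C F where "X = subst p \<^bold>\<top> A" and "S = \<^bold>\<box> \<^bold>\<not> X" and "C = subst p S A" and "F = C \<rhd> B"
  let ?L = "IL_minus {J4, J5}"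
  \<comment> \<open>\<open>S\<close> is literally the antecedent, so this is propositional.\<close>
  have "?L (\<^bold>\<box> \<^bold>\<not> X \<^bold>\<rightarrow> (S \<^bold>\<leftrightarrow> \<^bold>\<top>))"
    by (intro IL_minus.L1) (simp add: tautology_def S_def)
  from IL_subst_cong_boxed[OF assms this] have CX: "?L (\<^bold>\<box> \<^bold>\<not> X \<^bold>\<rightarrow> (C \<^bold>\<leftrightarrow> X))"
    by (simp add: C_def X_def)
  \<comment> \<open>Boxing this implication produces the premise of Loeb's axiom for the negation of
    \<open>X\<close>.\<close>
  have "?L (\<^bold>\<not> C \<^bold>\<rightarrow> (\<^bold>\<box> \<^bold>\<not> X \<^bold>\<rightarrow> \<^bold>\<not> X))"
    using CX by (rule IL_taut1) (unfold tautology_def bool_eval.simps, blast)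
  from IL_imp_trans[OF IL_Box_mono[OF this] IL_minus.L3]
  have CS: "?L (\<^bold>\<box> \<^bold>\<not> C \<^bold>\<rightarrow> S)" by (simp add: S_def)
  have "?L (\<^bold>\<box> \<^bold>\<not> X \<^bold>\<rightarrow> \<^bold>\<not> X \<^bold>\<rightarrow> \<^bold>\<not> C)"
    using CX by (rule IL_taut1) (unfold tautology_def bool_eval.simps, blast)
  from IL_Box_mono2[OF this] IL_four[of _ "\<^bold>\<not> X"]
  have SC: "?L (S \<^bold>\<rightarrow> \<^bold>\<box> \<^bold>\<not> C)"
    unfolding S_def by (rule IL_taut2) (unfold tautology_def bool_eval.simps, blast)
  have "?L (F \<^bold>\<rightarrow> (\<^bold>\<diamond> C \<^bold>\<rightarrow> \<^bold>\<diamond> B))"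
    by (rule IL_minus.Ax[of J4]) (auto simp: J4_def F_def)
  \<comment> \<open>The direction from \<open>F\<close> to \<open>S\<close> uses J4 and
    \<open>CS\<close>; conversely \<open>S\<close> refutes \<open>C\<close> under the box, which
    makes \<open>F\<close> hold vacuously.\<close>
  hence "?L (\<^bold>\<box> \<^bold>\<not> B \<^bold>\<rightarrow> (F \<^bold>\<leftrightarrow> S))"
    using CS IL_imp_trans[OF SC IL_Box_Neg_Rhd[of _ C B, folded F_def]]
    by (rule IL_taut3) (unfold tautology_def bool_eval.simps, blast)
  from IL_subst_cong_boxed[OF assms this]
  have *: "?L (\<^bold>\<box> \<^bold>\<not> B \<^bold>\<rightarrow> (subst p F A \<^bold>\<leftrightarrow> C))" by (simp add: C_def)
  have J5: "?L (\<^bold>\<diamond> B \<rhd> B)" by (rule IL_minus.Ax[of J5]) (auto simp: J5_def)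
  \<comment> \<open>Split on \<open>\<box> \<not> B\<close>: its negation is exactly
    \<open>\<diamond> B\<close>.\<close>
  have "?L (subst p F A \<^bold>\<rightarrow> C \<^bold>\<or> \<^bold>\<diamond> B)" "?L (C \<^bold>\<rightarrow> subst p F A \<^bold>\<or> \<^bold>\<diamond> B)"
    using * by (rule IL_taut1, unfold tautology_def bool_eval.simps, blast)+
  from this[THEN IL_Rhd_cases, of B] J5
  have "?L (F \<^bold>\<leftrightarrow> (subst p F A \<rhd> B))"
    unfolding F_def by (rule IL_taut3) (unfold tautology_def bool_eval.simps, blast)
  thus ?thesis by (simp add: F_def C_def S_def X_def)
qed

lemma vars_fp: "p \<notin> vars B \<Longrightarrow> vars (fp p A B) \<subseteq> vars (A \<rhd> B) - {p}"
  using vars_subst[of p "\<^bold>\<box> \<^bold>\<not> (subst p \<^bold>\<top> A)" A] vars_subst[of p "\<^bold>\<top>" A] by auto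

lemma rvars_fp: "p \<notin> rvars A \<Longrightarrow> rvars (fp p A B) \<subseteq> rvars (A \<rhd> B)"
  using rvars_subst[of p A "\<^bold>\<box> \<^bold>\<not> (subst p \<^bold>\<top> A)"] rvars_subst[of p A "\<^bold>\<top>"] by auto

section \<open>Fixed points of arbitrary left-modalized formulas\<close>

text \<open>The induction measure: occurrences of outermost modal components containing
  \<open>p\<close>. Nesting inside a component is not counted.\<close>

primrec modal_count :: "nat \<Rightarrow> fm \<Rightarrow> nat" where
  "modal_count p \<^bold>\<bottom> = 0"
| "modal_count p (Var q) = 0"
| "modal_count p (A \<^bold>\<rightarrow> B) = modal_count p A + modal_count p B"
| "modal_count p (\<^bold>\<box> A) = (if p \<in> vars A then 1 else 0)"
| "modal_count p (A \<rhd> B) = (if p \<in> vars A \<union> vars B then 1 else 0)"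

lemma modal_count_0: "modalized p D \<Longrightarrow> modal_count p D = 0 \<Longrightarrow> p \<notin> vars D"
  by (induction D) (auto split: if_splits)

text \<open>One component \<open>M\<close> is cut out and marked by \<open>q\<close>. For a box, J6
  supplies the form \<open>A \<rhd> B\<close>, hence an equivalence instead of an equality. The new
  \<open>q\<close> lies outside every modal operator, so it does not enter
  \<open>rvars D'\<close>.\<close>

lemma split_component:
  assumes "modalized p D" "modal_count p D > 0" "q \<notin> vars D" "q \<noteq> p"
  shows "\<exists>D' M A B. D = subst q M D' \<and> IL_minus \<Sigma> (M \<^bold>\<leftrightarrow> (A \<rhd> B))
     \<and> modalized p D' \<and> Suc (modal_count p D') = modal_count p D
     \<and> vars D' \<subseteq> insert q (vars D) \<and> rvars D' \<subseteq> rvars D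
     \<and> vars (A \<rhd> B) \<subseteq> vars D \<and> rvars (A \<rhd> B) \<subseteq> rvars D"
  using assms
proof (induction D)
  case (Imp D1 D2)
  show ?case
  proof (cases "modal_count p D1 > 0")
    case True
    with Imp.prems have "modalized p D1" "modal_count p D1 > 0" "q \<notin> vars D1" by auto
    from Imp.IH(1)[OF this Imp.prems(4)] obtain D' M A B where
      "D1 = subst q M D'" "IL_minus \<Sigma> (M \<^bold>\<leftrightarrow> (A \<rhd> B))"
      "modalized p D'" "Suc (modal_count p D') = modal_count p D1"
      "vars D' \<subseteq> insert q (vars D1)" "rvars D' \<subseteq> rvars D1"
      "vars (A \<rhd> B) \<subseteq> vars D1" "rvars (A \<rhd> B) \<subseteq> rvars D1"
      by (elim exE conjE) (rule that)
    with Imp.prems show ?thesis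
      by (intro exI[of _ "D' \<^bold>\<rightarrow> D2"] exI[of _ M] exI[of _ A] exI[of _ B] conjI)
        (simp_all, blast+)
  next
    case False
    with Imp.prems have "modalized p D2" "modal_count p D2 > 0" "q \<notin> vars D2" by auto
    from Imp.IH(2)[OF this Imp.prems(4)] obtain D' M A B where
      "D2 = subst q M D'" "IL_minus \<Sigma> (M \<^bold>\<leftrightarrow> (A \<rhd> B))"
      "modalized p D'" "Suc (modal_count p D') = modal_count p D2"
      "vars D' \<subseteq> insert q (vars D2)" "rvars D' \<subseteq> rvars D2"
      "vars (A \<rhd> B) \<subseteq> vars D2" "rvars (A \<rhd> B) \<subseteq> rvars D2"
      by (elim exE conjE) (rule that)
    with False Imp.prems show ?thesis
      by (intro exI[of _ "D1 \<^bold>\<rightarrow> D'"] exI[of _ M] exI[of _ A] exI[of _ B] conjI)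
        (simp_all, blast+)
  qed
next
  case (Box D)
  have "IL_minus \<Sigma> (\<^bold>\<box> D \<^bold>\<leftrightarrow> (\<^bold>\<not> D \<rhd> \<^bold>\<bottom>))" by (rule IL_minus.J6)
  with Box.prems show ?case
    by (intro exI[of _ "Var q"] exI[of _ "\<^bold>\<box> D"] exI[of _ "\<^bold>\<not> D"] exI[of _ "\<^bold>\<bottom>"])
      (auto split: if_splits)
next
  case (Rhd D1 D2)
  have "IL_minus \<Sigma> ((D1 \<rhd> D2) \<^bold>\<leftrightarrow> (D1 \<rhd> D2))"
    by (intro IL_minus.L1) (unfold tautology_def bool_eval.simps, blast)
  with Rhd.prems show ?case
    by (intro exI[of _ "Var q"] exI[of _ "D1 \<rhd> D2"] exI[of _ D1] exI[of _ D2])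
      (auto split: if_splits)
qed auto

text \<open>The bound on \<open>rvars G\<close> strengthens the induction hypothesis: it keeps the fresh variable out of
  the right arguments in the fixed point, so that the equation for that variable is left-modalized.\<close>

lemma left_modalized_fixed_point:
  assumes "modalized p D" "p \<notin> rvars D"
  shows "\<exists>G. vars G \<subseteq> vars D - {p} \<and> rvars G \<subseteq> rvars D
     \<and> IL_minus {J4, J5} (G \<^bold>\<leftrightarrow> subst p G D)"
  using assms
proof (induction "modal_count p D" arbitrary: D)
  case 0
  hence "p \<notin> vars D" using modal_count_0 by simp
  moreover have "IL_minus {J4, J5} (D \<^bold>\<leftrightarrow> D)"
    by (intro IL_minus.L1) (unfold tautology_def bool_eval.simps, blast)
  ultimately show ?case by (intro exI[of _ D]) simp
next
  case (Suc n)
  let ?L = "IL_minus {J4, J5}"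
  obtain q where "q \<notin> insert p (vars D)"
    using ex_new_if_finite[OF infinite_UNIV_nat] finite_vars finite_insert by metis
  hence q: "q \<noteq> p" "q \<notin> vars D" by auto
  from split_component[OF Suc.prems(1) _ q(2,1), of "{J4, J5}"] Suc.hyps(2)
  obtain D' M A B where D: "D = subst q M D'" and M: "?L (M \<^bold>\<leftrightarrow> (A \<rhd> B))"
    and D': "modalized p D'" "n = modal_count p D'"
      "vars D' \<subseteq> insert q (vars D)" "rvars D' \<subseteq> rvars D"
    and AB: "vars (A \<rhd> B) \<subseteq> vars D" "rvars (A \<rhd> B) \<subseteq> rvars D" by auto
  have "p \<notin> rvars D'" using D'(4) Suc.prems(2) by blast
  from Suc.hyps(1)[OF D'(2,1) this] obtain G where
    G: "vars G \<subseteq> vars D' - {p}" "rvars G \<subseteq> rvars D'" "?L (G \<^bold>\<leftrightarrow> subst p G D')" by blast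
  have p: "p \<notin> rvars A" "p \<notin> vars B" using AB(2) Suc.prems(2) by auto
  have qAB: "q \<notin> vars A" "q \<notin> vars B" using AB(1) q by auto
  have "q \<notin> rvars G" using G(2) D'(4) q rvars_subset_vars by blast
  \<comment> \<open>\<open>G\<close> may still contain \<open>q\<close>, so
    \<open>C \<rhd> B\<close> is an equation for \<open>q\<close>, left-modalized since
    \<open>q\<close> avoids \<open>rvars C\<close> and \<open>vars B\<close>; \<open>K\<close>
    solves it.\<close>
  define C where "C = subst p G A"
  have rC: "rvars C \<subseteq> rvars A \<union> rvars G" unfolding C_def using p(1) by (rule rvars_subst)
  have vC: "vars C \<subseteq> vars A - {p} \<union> vars G" unfolding C_def by (rule vars_subst)
  have "q \<notin> rvars A" using qAB(1) rvars_subset_vars by blast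
  hence qC: "q \<notin> rvars C" using rC \<open>q \<notin> rvars G\<close> by blast
  define K where "K = fp q C B"
  have K: "?L (K \<^bold>\<leftrightarrow> (subst q K C \<rhd> B))" unfolding K_def using qC by (rule fp_Rhd)
  have vK: "vars K \<subseteq> vars D - {p}"
  proof -
    have "vars (C \<rhd> B) - {q} \<subseteq> vars D - {p}"
      using vC p(2) AB(1) G(1) D'(3) by auto
    with vars_fp[OF qAB(2), of C] show ?thesis unfolding K_def by (rule subset_trans)
  qed
  have rK: "rvars K \<subseteq> rvars D"
  proof -
    have "rvars (C \<rhd> B) \<subseteq> rvars D"
      using rC AB(2) G(2) D'(4) by auto
    with rvars_fp[OF qC, of B] show ?thesis unfolding K_def by (rule subset_trans)
  qed
  \<comment> \<open>\<open>H\<close> is \<open>G\<close> with the solution for \<open>q\<close>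
    inserted; the claim is that it is a fixed point of \<open>D\<close>.\<close>
  define H where "H = subst q K G"
  have "q \<notin> vars K" using vK q by blast
  hence qH: "q \<notin> vars H" unfolding H_def by (rule notin_vars_subst)
  have "subst q K C = subst p H A"
    unfolding C_def H_def using qAB(1) by (rule subst_subst_fresh)
  with K p(2) have 1: "?L (K \<^bold>\<leftrightarrow> subst p H (A \<rhd> B))" by simp
  have "?L (subst p H M \<^bold>\<leftrightarrow> subst p H (A \<rhd> B))" using IL_J4_J5_subst[OF M, of p H] by simp
  with 1 have "?L (K \<^bold>\<leftrightarrow> subst p H M)" by (rule IL_taut2) (unfold tautology_def bool_eval.simps, blast)
  \<comment> \<open>\<open>K\<close> is equivalent to the component \<open>M\<close> evaluated at
    \<open>H\<close>, so it may be exchanged for that component in the slot marked by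
    \<open>q\<close>.\<close>
  hence 2: "?L (subst q K (subst p H D') \<^bold>\<leftrightarrow> subst q (subst p H M) (subst p H D'))"
    by (rule IL_subst_cong)
  have "?L (H \<^bold>\<leftrightarrow> subst q K (subst p G D'))" using IL_J4_J5_subst[OF G(3), of q K] by (simp add: H_def)
  \<comment> \<open>Replacing \<open>q\<close> by \<open>K\<close> also acts inside the inserted
    copies of \<open>G\<close>, turning them into \<open>H\<close>.\<close>
  also have "subst q K (subst p G D') = subst q K (subst p H D')"
    unfolding H_def using \<open>q \<notin> vars K\<close> q(1) by (intro subst_subst_outer) auto
  finally have "?L (H \<^bold>\<leftrightarrow> subst q (subst p H M) (subst p H D'))" using 2 by (rule IL_iff_trans)
  \<comment> \<open>As \<open>H\<close> is free of \<open>q\<close>, refilling the slot after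
    substituting for \<open>p\<close> gives the same formula as refilling it first, which restores
    \<open>D\<close>.\<close>
  also have "subst q (subst p H M) (subst p H D') = subst p H D"
    unfolding D using qH q(1) by (intro subst_subst_inner[symmetric]) auto
  finally have "?L (H \<^bold>\<leftrightarrow> subst p H D)" .
  moreover have "vars H \<subseteq> vars D - {p}"
    using vars_subst[of q K G] vK G(1) D'(3) unfolding H_def by blast
  moreover have "rvars H \<subseteq> rvars D"
    using rvars_subst[OF \<open>q \<notin> rvars G\<close>, of K] rK G(2) D'(4) unfolding H_def by blast
  ultimately show ?case by blast
qed

theorem theorem5p9:
  shows "(\<forall>p A B. left_modalized p (A \<rhd> B) \<longrightarrow>
            (let F = subst p (\<^bold>\<box> \<^bold>\<not> (subst p \<^bold>\<top> A)) A \<rhd> B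
             in IL_minus {J4, J5} (F \<^bold>\<leftrightarrow> (subst p F A \<rhd> B))))
       \<and> has_lFPP (IL_minus {J4, J5})"
proof (intro conjI allI impI)
  fix p A B
  assume "left_modalized p (A \<rhd> B)"
  hence "p \<notin> rvars A" by (simp add: left_modalized_iff)
  thus "let F = fp p A B in IL_minus {J4, J5} (F \<^bold>\<leftrightarrow> (subst p F A \<rhd> B))"
    unfolding Let_def by (rule fp_Rhd)
next
  show "has_lFPP (IL_minus {J4, J5})"
    unfolding has_lFPP_def left_modalized_iff using left_modalized_fixed_point by blast
qed

end
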